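(* Let $n\geq 2$ and let $W$ be the Coxeter group of type $A_n$. The Vogan representation $\phi$ of $W$ is faithful. In particular, $\mathrm{Ker}\,\phi=Z(W)$ is the trivial group.
   Context: The Coxeter graph of type $A_n$ has vertex set $S=\{s_1,\dots,s_n\}$ and edge set $R=\{s_is_{i+1} : 1\le i\le n-1\}$ (a path). The Coxeter group $W$ of type $A_n$ is generated by $S$ with relations $s^2=1$, $(ss')^3=1$ if $ss'\in R$, and $(ss')^2=1$ if $s\ne s'$, $ss'\notin R$. $F_2^n$ is the space of column vectors over the two-element field $F_2$ indexed by $S$, and $\widetilde{s}$ is the characteristic vector of $s\in S$. For $s\in S$, $\mathbf{s}$ is the $n\times n$ matrix over $F_2$ acting by $\mathbf{s}\widetilde{v}=\widetilde{v}$ for $v\ne s$ and $\mathbf{s}\widetilde{s}=\widetilde{s}+\sum_{us\in R}\widetilde{u}$. The Vogan representation of $W$ is the homomorphism $\phi:W\to\mathrm{GL}_n(F_2)$ with $\phi(s)=\mathbf{s}$ for $s\in S$. Faithful means injective; $Z(W)$ is the center of $W$. *)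

theory Defs
  imports "HOL-Algebra.Coset" "HOL-Library.Z2" "Jordan_Normal_Form.Matrix"
begin

section \<open>Groups given by generators and relations\<close>

text \<open>
  A word over \<open>S\<close> is a list of letters \<open>(s, b)\<close>: \<open>(s, True)\<close> stands for the generator \<open>s\<close> and
  \<open>(s, False)\<close> for its formal inverse.  \<open>pres_cong S Q\<close> is the least congruence on the words that
  contains free cancellation and identifies every relator in \<open>Q\<close> with the empty word, so that its
  quotient is the group with presentation \<open>\<langle>S | Q\<rangle>\<close>.
\<close>

definition words :: "'a set \<Rightarrow> ('a \<times> bool) list set" where
  "words S = lists (S \<times> UNIV)"

inductive_set pres_cong ::
    "'a set \<Rightarrow> ('a \<times> bool) list set \<Rightarrow> (('a \<times> bool) list \<times> ('a \<times> bool) list) set"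
  for S Q where
  refl: "w \<in> words S \<Longrightarrow> (w, w) \<in> pres_cong S Q"
| sym: "(u, v) \<in> pres_cong S Q \<Longrightarrow> (v, u) \<in> pres_cong S Q"
| trans: "(u, v) \<in> pres_cong S Q \<Longrightarrow> (v, w) \<in> pres_cong S Q \<Longrightarrow> (u, w) \<in> pres_cong S Q"
| append: "(u, u') \<in> pres_cong S Q \<Longrightarrow> (v, v') \<in> pres_cong S Q \<Longrightarrow>
    (u @ v, u' @ v') \<in> pres_cong S Q"
| cancel: "s \<in> S \<Longrightarrow> ([(s, b), (s, \<not> b)], []) \<in> pres_cong S Q"
| relator: "r \<in> Q \<Longrightarrow> r \<in> words S \<Longrightarrow> (r, []) \<in> pres_cong S Q"

definition pres_class ::
    "'a set \<Rightarrow> ('a \<times> bool) list set \<Rightarrow> ('a \<times> bool) list \<Rightarrow> ('a \<times> bool) list set" where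
  "pres_class S Q w = pres_cong S Q `` {w}"

definition presented_group ::
    "'a set \<Rightarrow> ('a \<times> bool) list set \<Rightarrow> ('a \<times> bool) list set monoid" where
  "presented_group S Q =
    \<lparr>carrier = words S // pres_cong S Q,
     Group.monoid.mult = (\<lambda>X Y. \<Union>u\<in>X. \<Union>v\<in>Y. pres_class S Q (u @ v)),
     one = pres_class S Q []\<rparr>"

lemma pres_cong_words: "(u, v) \<in> pres_cong S Q \<Longrightarrow> u \<in> words S \<and> v \<in> words S"
  by (induction rule: pres_cong.induct) (auto simp: words_def)

lemma equiv_pres_cong: "equiv (words S) (pres_cong S Q)"
proof (rule equivI)
  show "pres_cong S Q \<subseteq> words S \<times> words S"
    using pres_cong_words by fastforce
  show "refl_on (words S) (pres_cong S Q)"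
    by (auto simp: refl_on_def intro: pres_cong.refl)
  show "sym_on UNIV (pres_cong S Q)"
    by (auto intro!: symI pres_cong.sym)
  show "trans_on UNIV (pres_cong S Q)"
    by (auto intro!: transI intro: pres_cong.trans)
qed

lemma pres_class_eq_iff:
  assumes "u \<in> words S" "v \<in> words S"
  shows "pres_class S Q u = pres_class S Q v \<longleftrightarrow> (u, v) \<in> pres_cong S Q"
  unfolding pres_class_def using eq_equiv_class_iff[OF equiv_pres_cong assms] .

lemma pres_class_closed:
  "w \<in> words S \<Longrightarrow> pres_class S Q w \<in> carrier (presented_group S Q)"
  by (auto simp: presented_group_def pres_class_def intro: quotientI)

lemma presented_group_cases:
  assumes "X \<in> carrier (presented_group S Q)"
  obtains w where "w \<in> words S" "X = pres_class S Q w"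
  using assms by (auto simp: presented_group_def pres_class_def elim: quotientE)

lemma presented_group_mult:
  assumes "u \<in> words S" "v \<in> words S"
  shows "pres_class S Q u \<otimes>\<^bsub>presented_group S Q\<^esub> pres_class S Q v = pres_class S Q (u @ v)"
proof -
  have *: "pres_class S Q (u' @ v') = pres_class S Q (u @ v)"
    if "u' \<in> pres_class S Q u" "v' \<in> pres_class S Q v" for u' v'
  proof -
    have "(u @ v, u' @ v') \<in> pres_cong S Q"
      using that by (auto simp: pres_class_def intro: pres_cong.append)
    then show ?thesis
      using pres_class_eq_iff pres_cong_words by metis
  qed
  have "u \<in> pres_class S Q u" "v \<in> pres_class S Q v"
    using assms by (auto simp: pres_class_def intro: pres_cong.refl)
  then have "(\<Union>u'\<in>pres_class S Q u. \<Union>v'\<in>pres_class S Q v. pres_class S Q (u' @ v')) =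
      pres_class S Q (u @ v)"
    using * by blast
  then show ?thesis
    by (simp add: presented_group_def)
qed

lemma presented_group_one: "\<one>\<^bsub>presented_group S Q\<^esub> = pres_class S Q []"
  by (simp add: presented_group_def)

lemma words_Nil: "[] \<in> words S"
  and words_append: "u \<in> words S \<Longrightarrow> v \<in> words S \<Longrightarrow> u @ v \<in> words S"
  and words_Cons: "(s, b) # w \<in> words S \<longleftrightarrow> s \<in> S \<and> w \<in> words S"
  by (auto simp: words_def)

lemma words_inverse:
  assumes "w \<in> words S"
  shows "\<exists>v\<in>words S. (v @ w, []) \<in> pres_cong S Q"
  using assms
proof (induction w)
  case Nil
  then show ?case by (auto intro!: bexI[of _ "[]"] pres_cong.refl simp: words_Nil)
next
  case (Cons a w)
  obtain s b where a: "a = (s, b)" by (cases a)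
  with Cons obtain v where v: "v \<in> words S" "(v @ w, []) \<in> pres_cong S Q" "s \<in> S" "w \<in> words S"
    by (auto simp: words_Cons)
  have "([(s, \<not> b), (s, b)], []) \<in> pres_cong S Q"
    using pres_cong.cancel[OF v(3), of "\<not> b"] by simp
  then have "([(s, \<not> b), (s, b)] @ w, [] @ w) \<in> pres_cong S Q"
    by (rule pres_cong.append[OF _ pres_cong.refl[OF v(4)]])
  then have "(v @ ([(s, \<not> b), (s, b)] @ w), v @ ([] @ w)) \<in> pres_cong S Q"
    by (rule pres_cong.append[OF pres_cong.refl[OF v(1)]])
  then have "((v @ [(s, \<not> b)]) @ a # w, []) \<in> pres_cong S Q"
    using v(2) a by (auto intro: pres_cong.trans)
  then show ?case
    using v by (auto intro!: bexI[of _ "v @ [(s, \<not> b)]"] words_append simp: words_Cons words_Nil)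
qed

lemma group_presented_group: "group (presented_group S Q)"
proof (rule groupI)
  fix X Y Z
  assume "X \<in> carrier (presented_group S Q)" "Y \<in> carrier (presented_group S Q)"
    "Z \<in> carrier (presented_group S Q)"
  then show "X \<otimes>\<^bsub>presented_group S Q\<^esub> Y \<otimes>\<^bsub>presented_group S Q\<^esub> Z =
      X \<otimes>\<^bsub>presented_group S Q\<^esub> (Y \<otimes>\<^bsub>presented_group S Q\<^esub> Z)"
    by (elim presented_group_cases) (simp add: presented_group_mult words_append)
next
  fix X assume "X \<in> carrier (presented_group S Q)"
  then obtain w where w: "w \<in> words S" "X = pres_class S Q w"
    by (elim presented_group_cases)
  obtain v where v: "v \<in> words S" "(v @ w, []) \<in> pres_cong S Q"
    using words_inverse[OF w(1)] by blast
  then show "\<exists>Y\<in>carrier (presented_group S Q). Y \<otimes>\<^bsub>presented_group S Q\<^esub> X = \<one>\<^bsub>presented_group S Q\<^esub>"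
    using w by (intro bexI[of _ "pres_class S Q v"])
      (auto simp: presented_group_mult presented_group_one pres_class_eq_iff words_append words_Nil
        intro: pres_class_closed)
next
  fix X Y
  assume "X \<in> carrier (presented_group S Q)" "Y \<in> carrier (presented_group S Q)"
  then show "X \<otimes>\<^bsub>presented_group S Q\<^esub> Y \<in> carrier (presented_group S Q)"
    by (elim presented_group_cases) (simp add: presented_group_mult words_append pres_class_closed)
next
  show "\<one>\<^bsub>presented_group S Q\<^esub> \<in> carrier (presented_group S Q)"
    by (simp add: presented_group_one words_Nil pres_class_closed)
next
  fix X assume "X \<in> carrier (presented_group S Q)"
  then show "\<one>\<^bsub>presented_group S Q\<^esub> \<otimes>\<^bsub>presented_group S Q\<^esub> X = X"
    by (elim presented_group_cases) (simp add: presented_group_mult presented_group_one words_Nil)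
qed

text \<open>The universal property of the presentation (von Dyck's theorem).\<close>

definition letter_val :: "('b, 'c) monoid_scheme \<Rightarrow> ('a \<Rightarrow> 'b) \<Rightarrow> 'a \<times> bool \<Rightarrow> 'b" where
  "letter_val G f a = (if snd a then f (fst a) else inv\<^bsub>G\<^esub> f (fst a))"

definition word_val :: "('b, 'c) monoid_scheme \<Rightarrow> ('a \<Rightarrow> 'b) \<Rightarrow> ('a \<times> bool) list \<Rightarrow> 'b" where
  "word_val G f w = foldr (\<lambda>a g. letter_val G f a \<otimes>\<^bsub>G\<^esub> g) w \<one>\<^bsub>G\<^esub>"

lemma word_val_simps [simp]:
  "word_val G f [] = \<one>\<^bsub>G\<^esub>"
  "word_val G f (a # w) = letter_val G f a \<otimes>\<^bsub>G\<^esub> word_val G f w"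
  by (simp_all add: word_val_def)

context group
begin

lemma letter_val_closed: "f \<in> S \<rightarrow> carrier G \<Longrightarrow> s \<in> S \<Longrightarrow> letter_val G f (s, b) \<in> carrier G"
  by (auto simp: letter_val_def)

lemma word_val_closed: "f \<in> S \<rightarrow> carrier G \<Longrightarrow> w \<in> words S \<Longrightarrow> word_val G f w \<in> carrier G"
proof (induction w)
  case (Cons a w)
  then show ?case
    by (cases a) (auto simp: words_Cons letter_val_closed)
qed simp

lemma word_val_append:
  assumes "f \<in> S \<rightarrow> carrier G" "u \<in> words S" "v \<in> words S"
  shows "word_val G f (u @ v) = word_val G f u \<otimes> word_val G f v"
  using assms(2)
proof (induction u)
  case Nil
  then show ?case using word_val_closed[OF assms(1,3)] by simp
next
  case (Cons a u)
  then obtain s b where a: "a = (s, b)" "s \<in> S" "u \<in> words S"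
    by (cases a) (auto simp: words_Cons)
  show ?case
    using Cons.IH a word_val_closed[OF assms(1)] letter_val_closed[OF assms(1) a(2)] assms(3)
    by (simp add: m_assoc)
qed

lemma word_val_pres_cong:
  assumes f: "f \<in> S \<rightarrow> carrier G"
    and Q: "\<And>r. r \<in> Q \<Longrightarrow> r \<in> words S \<Longrightarrow> word_val G f r = \<one>"
    and "(u, v) \<in> pres_cong S Q"
  shows "word_val G f u = word_val G f v"
  using assms(3)
proof (induction rule: pres_cong.induct)
  case (append u u' v v')
  then show ?case
    using word_val_append[OF f] pres_cong_words by metis
next
  case (cancel s b)
  then have "f s \<in> carrier G" using f by auto
  then show ?case by (auto simp: letter_val_def)
qed (auto simp: Q)

lemma presented_group_hom_exists:
  assumes f: "f \<in> S \<rightarrow> carrier G"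
    and Q: "\<And>r. r \<in> Q \<Longrightarrow> r \<in> words S \<Longrightarrow> word_val G f r = \<one>"
  shows "\<exists>\<phi>\<in>hom (presented_group S Q) G. \<forall>s\<in>S. \<phi> (pres_class S Q [(s, True)]) = f s"
proof -
  define \<phi> where "\<phi> X = word_val G f (SOME w. w \<in> words S \<and> X = pres_class S Q w)" for X
  have val: "\<phi> (pres_class S Q w) = word_val G f w" if w: "w \<in> words S" for w
  proof -
    define v where "v = (SOME v. v \<in> words S \<and> pres_class S Q w = pres_class S Q v)"
    have "v \<in> words S \<and> pres_class S Q w = pres_class S Q v"
      unfolding v_def by (rule someI[of _ w]) (simp add: w)
    then have "(w, v) \<in> pres_cong S Q"
      using w pres_class_eq_iff by metis
    then have "word_val G f w = word_val G f v"
      by (intro word_val_pres_cong[OF f]) (auto intro: Q)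
    then show ?thesis by (simp add: \<phi>_def v_def)
  qed
  have "\<phi> \<in> hom (presented_group S Q) G"
    by (rule homI; elim presented_group_cases)
      (simp_all add: val presented_group_mult words_append word_val_append[OF f] word_val_closed[OF f])
  moreover have "\<phi> (pres_class S Q [(s, True)]) = f s" if "s \<in> S" for s
  proof -
    have "f s \<in> carrier G" using that f by auto
    then show ?thesis using that by (simp add: val words_Cons words_Nil letter_val_def)
  qed
  ultimately show ?thesis by blast
qed

lemma presented_group_hom_unique:
  assumes "\<phi> \<in> hom (presented_group S Q) G" "\<psi> \<in> hom (presented_group S Q) G"
    and "\<And>s. s \<in> S \<Longrightarrow> \<phi> (pres_class S Q [(s, True)]) = \<psi> (pres_class S Q [(s, True)])"
    and X: "X \<in> carrier (presented_group S Q)"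
  shows "\<phi> X = \<psi> X"
proof -
  let ?P = "presented_group S Q" and ?c = "pres_class S Q"
  interpret P: group ?P by (rule group_presented_group)
  interpret \<phi>: group_hom ?P G \<phi> by unfold_locales (rule assms(1))
  interpret \<psi>: group_hom ?P G \<psi> by unfold_locales (rule assms(2))
  obtain w where w: "w \<in> words S" "X = ?c w" using X by (elim presented_group_cases)
  have single: "\<phi> (?c [(s, b)]) = \<psi> (?c [(s, b)])" if s: "s \<in> S" for s b
  proof (cases b)
    case True
    then show ?thesis using assms(3)[OF s] by simp
  next
    case False
    have cl: "?c [(s, b)] \<in> carrier ?P" for b
      using s by (intro pres_class_closed) (simp add: words_Cons words_Nil)
    have "?c [(s, False)] \<otimes>\<^bsub>?P\<^esub> ?c [(s, True)] = \<one>\<^bsub>?P\<^esub>"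
      using pres_cong.cancel[OF s, of False Q] s
      by (simp add: presented_group_mult presented_group_one words_Cons words_Nil pres_class_eq_iff)
    then have "?c [(s, False)] = inv\<^bsub>?P\<^esub> ?c [(s, True)]"
      using P.inv_equality[OF _ cl cl] by simp
    then show ?thesis using False assms(3)[OF s] cl by simp
  qed
  have "\<phi> (?c w) = \<psi> (?c w)" using w(1)
  proof (induction w)
    case Nil
    then show ?case using \<phi>.hom_one \<psi>.hom_one by (simp add: presented_group_one)
  next
    case (Cons a w)
    then obtain s b where a: "a = (s, b)" "s \<in> S" "w \<in> words S"
      by (cases a) (auto simp: words_Cons)
    have "?c (a # w) = ?c [a] \<otimes>\<^bsub>?P\<^esub> ?c w"
      using a by (simp add: presented_group_mult words_Cons words_Nil)
    moreover have "?c [a] \<in> carrier ?P" "?c w \<in> carrier ?P"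
      using a by (auto intro!: pres_class_closed simp: words_Cons words_Nil)
    ultimately show ?case using Cons.IH single a by simp
  qed
  then show ?thesis using w by simp
qed

end

definition group_center :: "('a, 'b) monoid_scheme \<Rightarrow> 'a set" where
  "group_center G = {z \<in> carrier G. \<forall>x\<in>carrier G. z \<otimes>\<^bsub>G\<^esub> x = x \<otimes>\<^bsub>G\<^esub> z}"


section \<open>Coxeter groups of simply laced graphs\<close>

text \<open>
  A Coxeter graph has vertex set \<open>{0..<n}\<close> and edge set \<open>R :: nat set set\<close>; the vertex \<open>i\<close>
  is the generator \<open>s\<close> with index \<open>i + 1\<close> in the usual numbering, in accordance with the
  0-based indexing of vectors and matrices.
\<close>

definition typeA_edges :: "nat \<Rightarrow> nat set set" where
  "typeA_edges n = {{i, Suc i} | i. Suc i < n}"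

definition coxeter_relators :: "nat \<Rightarrow> nat set set \<Rightarrow> (nat \<times> bool) list set" where
  "coxeter_relators n R =
    {[(s, True), (s, True)] | s. s < n} \<union>
    {concat (replicate 3 [(s, True), (t, True)]) | s t. s < n \<and> t < n \<and> {s, t} \<in> R} \<union>
    {concat (replicate 2 [(s, True), (t, True)]) | s t. s < n \<and> t < n \<and> s \<noteq> t \<and> {s, t} \<notin> R}"

definition coxeter_group :: "nat \<Rightarrow> nat set set \<Rightarrow> (nat \<times> bool) list set monoid" where
  "coxeter_group n R = presented_group {0..<n} (coxeter_relators n R)"

definition coxeter_gen :: "nat \<Rightarrow> nat set set \<Rightarrow> nat \<Rightarrow> (nat \<times> bool) list set" where
  "coxeter_gen n R s = pres_class {0..<n} (coxeter_relators n R) [(s, True)]"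


section \<open>The Vogan representation\<close>

text \<open>The two-element field is the type \<^typ>\<open>bit\<close>.\<close>

definition GL_F2 :: "nat \<Rightarrow> bit mat monoid" where
  "GL_F2 n = units_of (ring_mat TYPE(bit) n ())"

text \<open>The matrix is given by its columns, the images of the characteristic vectors.\<close>

definition vogan_matrix :: "nat \<Rightarrow> nat set set \<Rightarrow> nat \<Rightarrow> bit mat" where
  "vogan_matrix n R s = mat_of_cols n
    (map (\<lambda>v. if v = s
              then unit_vec n s + finsum_vec TYPE(bit) n (unit_vec n) {u. u < n \<and> {u, s} \<in> R}
              else unit_vec n v) [0..<n])"

text \<open>
  By \<open>vogan_representation_exists\<close> and \<open>vogan_representation_unique\<close> below, this predicate
  determines a map on the carrier of the Coxeter group.
\<close>

definition vogan_representation ::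
    "nat \<Rightarrow> nat set set \<Rightarrow> ((nat \<times> bool) list set \<Rightarrow> bit mat) \<Rightarrow> bool" where
  "vogan_representation n R \<phi> \<longleftrightarrow>
    \<phi> \<in> hom (coxeter_group n R) (GL_F2 n) \<and>
    (\<forall>s<n. \<phi> (coxeter_gen n R s) = vogan_matrix n R s)"

lemma group_coxeter_group: "group (coxeter_group n R)"
  unfolding coxeter_group_def by (rule group_presented_group)

lemma group_GL_F2: "group (GL_F2 n)"
  unfolding GL_F2_def
  by (intro monoid.units_group ring.is_monoid ring_mat)

lemma GL_F2_simps: "\<one>\<^bsub>GL_F2 n\<^esub> = 1\<^sub>m n" "A \<otimes>\<^bsub>GL_F2 n\<^esub> B = A * B"
  by (simp_all add: GL_F2_def units_of_def ring_mat_def)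

lemma vogan_matrix_carrier [simp]: "vogan_matrix n R s \<in> carrier_mat n n"
  unfolding vogan_matrix_def by (rule carrier_matI) simp_all

lemma vogan_matrix_dim [simp]:
  "dim_row (vogan_matrix n R s) = n" "dim_col (vogan_matrix n R s) = n"
  by (auto simp: vogan_matrix_def)

lemma mult_mat_unit_vec:
  fixes A :: "'a :: comm_semiring_1 mat"
  assumes "A \<in> carrier_mat n n" "j < n"
  shows "A *\<^sub>v unit_vec n j = col A j"
proof (rule eq_vecI)
  fix i assume "i < dim_vec (col A j)"
  with assms show "(A *\<^sub>v unit_vec n j) $ i = col A j $ i"
    by (simp add: scalar_prod_right_unit)
qed simp

lemma vogan_matrix_unit_vec:
  assumes "v < n"
  shows "vogan_matrix n R s *\<^sub>v unit_vec n v =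
    (if v = s then unit_vec n s + finsum_vec TYPE(bit) n (unit_vec n) {u. u < n \<and> {u, s} \<in> R}
     else unit_vec n v)"
proof -
  have "finsum_vec TYPE(bit) n (unit_vec n) {u. u < n \<and> {u, s} \<in> R} \<in> carrier_vec n"
    by (rule finsum_vec_closed) auto
  moreover have "vogan_matrix n R s *\<^sub>v unit_vec n v = col (vogan_matrix n R s) v"
    using assms by (intro mult_mat_unit_vec) simp_all
  ultimately show ?thesis
    using assms by (auto simp: vogan_matrix_def)
qed

lemma vogan_matrix_index:
  assumes "i < n" "j < n"
  shows "vogan_matrix n R s $$ (i, j) =
    (if i = j then 1 else 0) + (if j = s \<and> {i, s} \<in> R then 1 else 0)"
proof -
  have "finsum_vec TYPE(bit) n (unit_vec n) {u. u < n \<and> {u, s} \<in> R} $ i =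
      (\<Sum>u | u < n \<and> {u, s} \<in> R. unit_vec n u $ i)"
    using assms by (intro index_finsum_vec) auto
  also have "\<dots> = (\<Sum>u | u < n \<and> {u, s} \<in> R. if u = i then 1 else 0)"
    using assms by (intro sum.cong) auto
  also have "\<dots> = (if {i, s} \<in> R then 1 else 0)"
    using assms by (subst sum.delta) auto
  finally have sum: "finsum_vec TYPE(bit) n (unit_vec n) {u. u < n \<and> {u, s} \<in> R} $ i =
      (if {i, s} \<in> R then 1 else 0)" .
  have "finsum_vec TYPE(bit) n (unit_vec n) {u. u < n \<and> {u, s} \<in> R} \<in> carrier_vec n"
    by (rule finsum_vec_closed) auto
  then show ?thesis
    using assms sum by (auto simp: vogan_matrix_def mat_of_cols_index)
qed

lemma vogan_matrix_action:
  assumes "x \<in> carrier_vec n" "i < n" "s < n"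
  shows "(vogan_matrix n R s *\<^sub>v x) $ i = x $ i + (if {i, s} \<in> R then x $ s else 0)"
proof -
  have "(vogan_matrix n R s *\<^sub>v x) $ i = (\<Sum>j\<in>{0..<n}. vogan_matrix n R s $$ (i, j) * x $ j)"
    using assms by (auto simp: scalar_prod_def)
  also have "\<dots> = (\<Sum>j\<in>{0..<n}. (if j = i then x $ j else 0) +
      (if j = s then (if {i, s} \<in> R then x $ j else 0) else 0))"
    using assms by (intro sum.cong) (auto simp: vogan_matrix_index distrib_right)
  also have "\<dots> = x $ i + (if {i, s} \<in> R then x $ s else 0)"
    using assms by (simp only: sum.distrib sum.delta finite_atLeastLessThan atLeastLessThan_iff) simp
  finally show ?thesis .
qed

lemma mat_eq_oneI:
  fixes A :: "'a :: comm_semiring_1 mat"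
  assumes A: "A \<in> carrier_mat n n" and *: "\<And>x. x \<in> carrier_vec n \<Longrightarrow> A *\<^sub>v x = x"
  shows "A = 1\<^sub>m n"
proof (rule eq_matI)
  fix i j assume "i < dim_row (1\<^sub>m n :: 'a mat)" "j < dim_col (1\<^sub>m n :: 'a mat)"
  then have ij: "i < n" "j < n" by auto
  have "A *\<^sub>v unit_vec n j = col A j"
    using ij A by (intro mult_mat_unit_vec)
  then have "col A j = unit_vec n j" using * by simp
  moreover have "A $$ (i, j) = col A j $ i" using ij A by auto
  ultimately show "A $$ (i, j) = 1\<^sub>m n $$ (i, j)" using ij by auto
qed (use A in auto)

lemma vogan_matrix_sq:
  assumes "s < n" "{s} \<notin> R"
  shows "vogan_matrix n R s * vogan_matrix n R s = 1\<^sub>m n"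
proof (rule mat_eq_oneI)
  fix x :: "bit vec" assume x: "x \<in> carrier_vec n"
  let ?M = "vogan_matrix n R s"
  have cl: "?M *\<^sub>v y \<in> carrier_vec n" for y
    by (rule carrier_vecI) simp
  have "?M *\<^sub>v (?M *\<^sub>v x) = x"
  proof (rule eq_vecI)
    fix i assume "i < dim_vec x"
    then show "(?M *\<^sub>v (?M *\<^sub>v x)) $ i = x $ i"
      using assms x cl
      by (cases "x $ i"; cases "x $ s") (simp_all add: vogan_matrix_action del: index_mult_mat_vec)
  qed (use x in simp)
  then show "(?M * ?M) *\<^sub>v x = x"
    using x by (simp only: assoc_mult_mat_vec[OF vogan_matrix_carrier vogan_matrix_carrier])
qed (rule mult_carrier_mat[OF vogan_matrix_carrier vogan_matrix_carrier])

lemma vogan_matrix_in_GL: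
  assumes "s < n" "{s} \<notin> R"
  shows "vogan_matrix n R s \<in> carrier (GL_F2 n)"
proof -
  have "vogan_matrix n R s \<in> Units (ring_mat TYPE(bit) n ())"
    unfolding Units_def ring_mat_def
    using vogan_matrix_sq[OF assms] vogan_matrix_carrier[of n R s] by auto
  then show ?thesis by (simp add: GL_F2_def units_of_def)
qed

text \<open>A simple graph has no loops, i.e. no edge is a singleton.\<close>

theorem vogan_representation_exists:
  assumes loopless: "\<And>s. s < n \<Longrightarrow> {s} \<notin> R"
  shows "\<exists>\<phi>. vogan_representation n R \<phi>"
proof -
  let ?M = "vogan_matrix n R"
  interpret GL: group "GL_F2 n" by (rule group_GL_F2)
  have cl: "?M s *\<^sub>v y \<in> carrier_vec n" for s y
    by (rule carrier_vecI) simp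
  have cm: "?M s * A \<in> carrier_mat n n" if "A \<in> carrier_mat n n" for s A
    using that by (rule mult_carrier_mat[OF vogan_matrix_carrier])
  have mv: "(?M s * A) *\<^sub>v y = ?M s *\<^sub>v (A *\<^sub>v y)"
    if "A \<in> carrier_mat n n" "y \<in> carrier_vec n" for s A y
    using that by (rule assoc_mult_mat_vec[OF vogan_matrix_carrier])
  note act = vogan_matrix_action
  have f: "?M \<in> {0..<n} \<rightarrow> carrier (GL_F2 n)"
    using vogan_matrix_in_GL loopless by auto
  have rel: "word_val (GL_F2 n) ?M r = \<one>\<^bsub>GL_F2 n\<^esub>" if "r \<in> coxeter_relators n R" for r
  proof -
    from that consider (sq) s where "s < n" "r = [(s, True), (s, True)]"
      | (edge) s t where "s < n" "t < n" "{s, t} \<in> R" "r = concat (replicate 3 [(s, True), (t, True)])"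
      | (nonedge) s t where "s < n" "t < n" "s \<noteq> t" "{s, t} \<notin> R"
          "r = concat (replicate 2 [(s, True), (t, True)])"
      unfolding coxeter_relators_def by blast
    then show ?thesis
    proof cases
      case sq
      then show ?thesis
        using loopless by (simp add: letter_val_def GL_F2_simps vogan_matrix_sq right_mult_one_mat[of _ n n])
    next
      case edge
      have [simp]: "{t, s} \<in> R" "{t} \<notin> R" "{s} \<notin> R"
        using edge loopless by (auto simp: insert_commute)
      have eq: "word_val (GL_F2 n) ?M r = ?M s * (?M t * (?M s * (?M t * (?M s * (?M t * 1\<^sub>m n)))))"
        using edge by (simp add: letter_val_def GL_F2_simps eval_nat_numeral)
      have "word_val (GL_F2 n) ?M r = 1\<^sub>m n"
        unfolding eq
      proof (rule mat_eq_oneI)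
        fix x :: "bit vec" assume x: "x \<in> carrier_vec n"
        show "?M s * (?M t * (?M s * (?M t * (?M s * (?M t * 1\<^sub>m n))))) *\<^sub>v x = x"
        proof (rule eq_vecI)
          fix i assume "i < dim_vec x"
          then show "(?M s * (?M t * (?M s * (?M t * (?M s * (?M t * 1\<^sub>m n))))) *\<^sub>v x) $ i = x $ i"
            using x edge cl cm
            by (cases "x $ i"; cases "x $ s"; cases "x $ t")
              (simp_all add: mv act del: index_mult_mat_vec)
        qed (use x in simp)
      qed (intro cm, simp)
      then show ?thesis by (simp add: GL_F2_simps)
    next
      case nonedge
      have [simp]: "{t, s} \<notin> R" "{t} \<notin> R" "{s} \<notin> R"
        using nonedge loopless by (auto simp: insert_commute)
      have eq: "word_val (GL_F2 n) ?M r = ?M s * (?M t * (?M s * (?M t * 1\<^sub>m n)))"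
        using nonedge by (simp add: letter_val_def GL_F2_simps eval_nat_numeral)
      have "word_val (GL_F2 n) ?M r = 1\<^sub>m n"
        unfolding eq
      proof (rule mat_eq_oneI)
        fix x :: "bit vec" assume x: "x \<in> carrier_vec n"
        show "?M s * (?M t * (?M s * (?M t * 1\<^sub>m n))) *\<^sub>v x = x"
        proof (rule eq_vecI)
          fix i assume "i < dim_vec x"
          then show "(?M s * (?M t * (?M s * (?M t * 1\<^sub>m n))) *\<^sub>v x) $ i = x $ i"
            using x nonedge cl cm
            by (cases "x $ i"; cases "x $ s"; cases "x $ t")
              (simp_all add: mv act del: index_mult_mat_vec)
        qed (use x in simp)
      qed (intro cm, simp)
      then show ?thesis by (simp add: GL_F2_simps)
    qed
  qed
  show ?thesis
    using GL.presented_group_hom_exists[OF f, of "coxeter_relators n R"] rel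
    by (auto simp: vogan_representation_def coxeter_group_def coxeter_gen_def)
qed

theorem vogan_representation_unique:
  assumes "vogan_representation n R \<phi>" "vogan_representation n R \<psi>"
    and "X \<in> carrier (coxeter_group n R)"
  shows "\<phi> X = \<psi> X"
proof -
  interpret GL: group "GL_F2 n" by (rule group_GL_F2)
  show ?thesis
    using assms GL.presented_group_hom_unique[of \<phi> "{0..<n}" "coxeter_relators n R" \<psi> X]
    by (simp add: vogan_representation_def coxeter_group_def coxeter_gen_def)
qed

corollary vogan_representation_typeA_exists: "\<exists>\<phi>. vogan_representation n (typeA_edges n) \<phi>"
  by (rule vogan_representation_exists) (auto simp: typeA_edges_def)

end

theory Submission
  imports Defs "HOL-Combinatorics.Permutations"
begin

text \<open>
  Put \<open>x\<^sub>i = y\<^sub>i + y\<^sub>i\<^sub>+\<^sub>1\<close> for \<open>y \<in> F\<^sub>2\<^sup>n\<^sup>+\<^sup>1\<close>. The matrix of the \<open>s\<close>-th generator then acts on \<open>x\<close> by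
  exchanging \<open>y\<^sub>s\<close> and \<open>y\<^sub>s\<^sub>+\<^sub>1\<close>, so the Vogan representation is the permutation module
  \<open>F\<^sub>2\<^sup>n\<^sup>+\<^sup>1\<close> modulo the all-one vector. As \<open>n + 1 \<ge> 3\<close>, the complement of a singleton is not a
  singleton, so the matrix of a word determines the permutation of \<open>{0..n}\<close> that it induces.
  Conversely, a word inducing the identity is trivial in \<open>W\<close>: every word in the generators below
  \<open>m\<close> equals \<open>u s\<^sub>m\<^sub>-\<^sub>1 s\<^sub>m\<^sub>-\<^sub>2 \<dots> s\<^sub>k\<close> with \<open>u\<close> a word in the generators below \<open>m - 1\<close>, and the
  permutation, which maps \<open>m\<close> to \<open>k\<close>, detects \<open>k\<close>. The centre is trivial because a
  permutation commuting with all \<open>(i, i + 1)\<close> preserves every set \<open>{i, i + 1}\<close>.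
\<close>

section \<open>Words in the Coxeter generators\<close>

lemma typeA_edges_iff: "{s, t} \<in> typeA_edges n \<longleftrightarrow> t = Suc s \<and> t < n \<or> s = Suc t \<and> s < n"
  by (auto simp: typeA_edges_def doubleton_eq_iff)

text \<open>Words without formal inverses suffice because every generator is an involution;
  \<open>typeA_class_cases\<close> shows that they reach every element of the group.\<close>

definition gen_word :: "nat list \<Rightarrow> (nat \<times> bool) list" where
  "gen_word = map (\<lambda>s. (s, True))"

lemma gen_word_simps [simp]:
  "gen_word [] = []"
  "gen_word (s # w) = (s, True) # gen_word w"
  "gen_word (u @ v) = gen_word u @ gen_word v"
  by (simp_all add: gen_word_def)

lemma gen_word_in_words: "gen_word w \<in> words {0..<n} \<longleftrightarrow> set w \<subseteq> {..<n}"
  by (auto simp: gen_word_def words_def)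

definition typeA_eq :: "nat \<Rightarrow> nat list \<Rightarrow> nat list \<Rightarrow> bool" where
  "typeA_eq n u v \<longleftrightarrow>
    (gen_word u, gen_word v) \<in> pres_cong {0..<n} (coxeter_relators n (typeA_edges n))"

lemma typeA_eq_refl: "set w \<subseteq> {..<n} \<Longrightarrow> typeA_eq n w w"
  unfolding typeA_eq_def by (simp add: pres_cong.refl gen_word_in_words)

lemma typeA_eq_sym: "typeA_eq n u v \<Longrightarrow> typeA_eq n v u"
  unfolding typeA_eq_def by (rule pres_cong.sym)

lemma typeA_eq_trans [trans]: "typeA_eq n u v \<Longrightarrow> typeA_eq n v w \<Longrightarrow> typeA_eq n u w"
  unfolding typeA_eq_def by (rule pres_cong.trans)

lemma typeA_eq_append: "typeA_eq n u u' \<Longrightarrow> typeA_eq n v v' \<Longrightarrow> typeA_eq n (u @ v) (u' @ v')"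
  unfolding typeA_eq_def by (simp add: pres_cong.append)

lemma typeA_eq_context:
  assumes "typeA_eq n u v" "set a \<subseteq> {..<n}" "set b \<subseteq> {..<n}"
  shows "typeA_eq n (a @ u @ b) (a @ v @ b)"
  using assms by (intro typeA_eq_append typeA_eq_refl)

lemma typeA_eq_set: "typeA_eq n u v \<Longrightarrow> set u \<subseteq> {..<n} \<and> set v \<subseteq> {..<n}"
  unfolding typeA_eq_def using pres_cong_words gen_word_in_words by blast

lemma typeA_eq_square: "s < n \<Longrightarrow> typeA_eq n [s, s] []"
  unfolding typeA_eq_def
  by (auto simp: coxeter_relators_def words_Cons words_Nil intro!: pres_cong.relator)

lemma typeA_eq_append_rev:
  assumes "set w \<subseteq> {..<n}"
  shows "typeA_eq n (w @ rev w) []"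
  using assms
proof (induction w)
  case (Cons s w)
  then have "typeA_eq n ([s] @ (w @ rev w) @ [s]) ([s] @ [] @ [s])"
    by (intro typeA_eq_context) auto
  also have "typeA_eq n ([s] @ [] @ [s]) []"
    using Cons.prems typeA_eq_square by simp
  finally show ?case by simp
qed (simp add: typeA_eq_refl)

text \<open>The reversed word is an inverse, since the generators are involutions. This turns a
  relator, cut in the middle, into an equation between its halves.\<close>

lemma typeA_eq_rev_if_append_trivial:
  assumes "typeA_eq n (u @ v) []"
  shows "typeA_eq n u (rev v)"
proof -
  have set: "set u \<subseteq> {..<n}" "set v \<subseteq> {..<n}" using typeA_eq_set[OF assms] by auto
  have "typeA_eq n (u @ (v @ rev v) @ []) (u @ [] @ [])"
    using set by (intro typeA_eq_context typeA_eq_append_rev) auto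
  then have "typeA_eq n u ((u @ v) @ rev v)" using typeA_eq_sym by simp
  also have "typeA_eq n ((u @ v) @ rev v) ([] @ rev v)"
    using assms set by (intro typeA_eq_append typeA_eq_refl) auto
  finally show ?thesis by simp
qed

lemma typeA_eq_commute:
  assumes "i < n" "j < n" "Suc i < j \<or> Suc j < i"
  shows "typeA_eq n [i, j] [j, i]"
proof -
  have "gen_word [i, j, i, j] \<in> coxeter_relators n (typeA_edges n)"
    using assms unfolding coxeter_relators_def
    by (auto simp: typeA_edges_iff eval_nat_numeral)
  moreover have "gen_word [i, j, i, j] \<in> words {0..<n}"
    using assms by (subst gen_word_in_words) auto
  ultimately have "typeA_eq n ([i, j] @ [i, j]) []"
    unfolding typeA_eq_def by (simp add: pres_cong.relator)
  from typeA_eq_rev_if_append_trivial[OF this] show ?thesis by simp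
qed

text \<open>The relator of an edge is cut into two halves of length three; the second is a
  palindrome and so its own inverse.\<close>

lemma typeA_eq_braid:
  assumes "Suc i < n"
  shows "typeA_eq n [Suc i, i, Suc i] [i, Suc i, i]"
proof -
  have "gen_word [Suc i, i, Suc i, i, Suc i, i] \<in> coxeter_relators n (typeA_edges n)"
    using assms unfolding coxeter_relators_def
    by (auto simp: typeA_edges_iff eval_nat_numeral)
  moreover have "gen_word [Suc i, i, Suc i, i, Suc i, i] \<in> words {0..<n}"
    using assms by (subst gen_word_in_words) auto
  ultimately have "typeA_eq n ([Suc i, i, Suc i] @ [i, Suc i, i]) []"
    unfolding typeA_eq_def by (simp add: pres_cong.relator)
  from typeA_eq_rev_if_append_trivial[OF this] show ?thesis by simp
qed

section \<open>Normal form with a descending right factor\<close>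

lemma typeA_eq_commute_word:
  assumes "i < n" "set w \<subseteq> {..<n}" "\<forall>j\<in>set w. Suc i < j \<or> Suc j < i"
  shows "typeA_eq n (w @ [i]) (i # w)"
  using assms(2,3)
proof (induction w)
  case Nil
  then show ?case using assms(1) by (simp add: typeA_eq_refl)
next
  case (Cons j w)
  then have "typeA_eq n ([j] @ (w @ [i]) @ []) ([j] @ (i # w) @ [])"
    by (intro typeA_eq_context) auto
  also have "typeA_eq n ([j] @ (i # w) @ []) ([] @ [i, j] @ w)"
    using typeA_eq_context[OF typeA_eq_commute[of j n i], of "[]" w] Cons.prems assms(1) by auto
  finally show ?case by simp
qed

text \<open>The words \<open>rev [k..<m]\<close> with \<open>k \<le> m\<close> represent the right
  cosets of the subgroup generated by the letters below \<open>m - 1\<close> in the one generated by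
  the letters below \<open>m\<close>. Right multiplication by a letter permutes these cosets;
  \<open>u\<close> is the factor from the subgroup.\<close>

lemma descending_word_mult:
  assumes "k \<le> m" "m \<le> n" "i < m"
  shows "\<exists>u k'. set u \<subseteq> {..<m - 1} \<and> k' \<le> m \<and>
    typeA_eq n (rev [k..<m] @ [i]) (u @ rev [k'..<m])"
proof -
  have desc: "set (rev [l..<m]) \<subseteq> {..<n}" for l
    using assms(2) by auto
  \<comment> \<open>A letter equal to the last letter \<open>k\<close> cancels it, and the letter
    just below \<open>k\<close> prolongs the descent. Any other letter passes through and emerges on
    the left, unchanged if it is below \<open>k - 1\<close> and lowered by one if it is above
    \<open>k\<close>.\<close>
  consider "i = k" | "Suc i = k" | "Suc i < k" | "k < i" by linarith
  then show ?thesis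
  proof cases
    case 1
    have "typeA_eq n (rev [Suc i..<m] @ [i, i] @ []) (rev [Suc i..<m] @ [] @ [])"
      using assms by (intro typeA_eq_context typeA_eq_square) auto
    then have "typeA_eq n (rev [k..<m] @ [i]) ([] @ rev [Suc i..<m])"
      using 1 assms by (simp add: upt_conv_Cons[of k m])
    moreover have "Suc i \<le> m" using assms by simp
    ultimately show ?thesis by (metis empty_set empty_subsetI)
  next
    case 2
    have "typeA_eq n (rev [k..<m] @ [i]) ([] @ rev [i..<m])"
      using 2 assms typeA_eq_refl[OF desc[of i]] by (simp add: upt_conv_Cons[of i m])
    moreover have "i \<le> m" using assms by simp
    ultimately show ?thesis by (metis empty_set empty_subsetI)
  next
    case 3
    have "typeA_eq n (rev [k..<m] @ [i]) ([i] @ rev [k..<m])"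
      using typeA_eq_commute_word[of i n "rev [k..<m]", OF _ desc] 3 assms by simp
    moreover have "set [i] \<subseteq> {..<m - 1}" using 3 assms by auto
    ultimately show ?thesis using assms(1) by blast
  next
    case 4
    then obtain j where j: "i = Suc j" "k \<le> j" by (cases i) auto
    let ?h = "rev [Suc i..<m]" and ?l = "rev [k..<j]"
    have split: "rev [k..<m] = ?h @ [i, j] @ ?l"
    proof -
      have "[k..<m] = [k..<j] @ [j..<m]"
        using j assms upt_add_eq_append[of k j "m - j"] by simp
      also have "[j..<m] = j # i # [Suc i..<m]"
        using j assms by (simp add: upt_conv_Cons)
      finally show ?thesis by simp
    qed
    have h: "set ?h \<subseteq> {..<n}" and l: "set ?l \<subseteq> {..<n}" using j assms by auto
    \<comment> \<open>The final \<open>i\<close> moves left across the lower letters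
      \<open>?l\<close>, the braid relation turns \<open>i j i\<close> into \<open>j i j\<close>,
      and the new leading \<open>j\<close> moves left across the higher letters
      \<open>?h\<close>.\<close>
    have "typeA_eq n ((?h @ [i, j]) @ (?l @ [i]) @ []) ((?h @ [i, j]) @ (i # ?l) @ [])"
      using j assms by (intro typeA_eq_context typeA_eq_commute_word) auto
    also have "typeA_eq n ((?h @ [i, j]) @ (i # ?l) @ []) (?h @ [j, i, j] @ ?l)"
      using typeA_eq_context[OF typeA_eq_braid[of j n] h l] j assms by simp
    also have "typeA_eq n (?h @ [j, i, j] @ ?l) ((j # ?h) @ [i, j] @ ?l)"
      using typeA_eq_context[OF typeA_eq_commute_word[of j n ?h], of "[]" "[i, j] @ ?l"] j h l assms
      by auto
    finally have "typeA_eq n (rev [k..<m] @ [i]) ([j] @ rev [k..<m])"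
      by (simp add: split)
    moreover have "set [j] \<subseteq> {..<m - 1}" using j assms by auto
    ultimately show ?thesis using assms(1) by blast
  qed
qed

text \<open>Appending one letter at a time keeps the form: the descending factor absorbs the letter
  and hands at most a factor with letters below \<open>m - 1\<close> to \<open>u\<close>.\<close>

lemma typeA_normal_form:
  assumes "m \<le> n" "set w \<subseteq> {..<m}"
  shows "\<exists>u k. set u \<subseteq> {..<m - 1} \<and> k \<le> m \<and> typeA_eq n w (u @ rev [k..<m])"
  using assms(2)
proof (induction w rule: rev_induct)
  case Nil
  have "typeA_eq n [] ([] @ rev [m..<m])" by (simp add: typeA_eq_refl)
  then show ?case by (metis empty_set empty_subsetI order_refl)
next
  case (snoc i w)
  then obtain u k where u: "set u \<subseteq> {..<m - 1}" "k \<le> m" "typeA_eq n w (u @ rev [k..<m])"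
    by auto
  from snoc.prems have i: "i < m" by simp
  obtain u' k' where u': "set u' \<subseteq> {..<m - 1}" "k' \<le> m"
      "typeA_eq n (rev [k..<m] @ [i]) (u' @ rev [k'..<m])"
    using descending_word_mult[OF u(2) assms(1) i] by blast
  have "typeA_eq n (w @ [i]) ((u @ rev [k..<m]) @ [i])"
    using u i assms(1) by (intro typeA_eq_append typeA_eq_refl) auto
  also have "typeA_eq n ((u @ rev [k..<m]) @ [i]) (u @ u' @ rev [k'..<m])"
    using u u' assms(1) typeA_eq_append[OF typeA_eq_refl u'(3), of u] by force
  finally have "typeA_eq n (w @ [i]) ((u @ u') @ rev [k'..<m])" by simp
  moreover have "set (u @ u') \<subseteq> {..<m - 1}" using u u' by simp
  ultimately show ?case using u'(2) by blast
qed

section \<open>The permutation induced by a word\<close>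

text \<open>The first letter acts first, so that words act on functions \<open>y\<close> from the left by \<open>y \<circ> word_perm w\<close>.\<close>

primrec word_perm :: "nat list \<Rightarrow> nat \<Rightarrow> nat" where
  "word_perm [] = id"
| "word_perm (s # w) = word_perm w \<circ> transpose s (Suc s)"

lemma word_perm_append: "word_perm (u @ v) = word_perm v \<circ> word_perm u"
  by (induction u) (simp_all add: comp_assoc)

lemma word_perm_permutes: "set w \<subseteq> {..<n} \<Longrightarrow> word_perm w permutes {..n}"
proof (induction w)
  case (Cons s w)
  then show ?case
    unfolding word_perm.simps by (intro permutes_compose permutes_swap_id) auto
qed (simp add: permutes_id[unfolded id_def] id_def)

text \<open>The letters \<open>m - 1\<close> down to \<open>k\<close> act in this order, each
  carrying the image of \<open>m\<close> one step down.\<close>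

lemma word_perm_descending: "k \<le> m \<Longrightarrow> word_perm (rev [k..<m]) m = k"
  by (induction m rule: dec_induct) simp_all

lemma word_perm_typeA_eq:
  assumes "typeA_eq n u v"
  shows "word_perm u = word_perm v"
proof -
  have fst_gen_word: "map fst (gen_word w) = w" for w
    by (simp add: gen_word_def comp_def)
  have relator: "word_perm (map fst r) = id"
    if "r \<in> coxeter_relators n (typeA_edges n)" for r
  proof -
    from that consider (sq) s where "r = gen_word [s, s]"
      | (edge) s t where "t = Suc s \<or> s = Suc t" "r = gen_word [s, t, s, t, s, t]"
      | (nonedge) s t where "s \<noteq> t" "t \<noteq> Suc s" "s \<noteq> Suc t" "r = gen_word [s, t, s, t]"
      unfolding coxeter_relators_def by (auto simp: typeA_edges_iff eval_nat_numeral)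
    then show ?thesis
      by cases (auto simp: fun_eq_iff transpose_def)
  qed
  \<comment> \<open>A derivation of the congruence may pass through formal inverses. Forgetting the
    exponents with \<open>map fst\<close> is harmless because transpositions are
    involutions.\<close>
  have "word_perm (map fst u) = word_perm (map fst v)"
    if "(u, v) \<in> pres_cong {0..<n} (coxeter_relators n (typeA_edges n))" for u v
    using that by induction (simp_all add: word_perm_append relator)
  from this[of "gen_word u" "gen_word v"] show ?thesis
    using assms by (simp add: typeA_eq_def fst_gen_word)
qed

text \<open>The bound \<open>m\<close> on the letters drops in the induction while the group stays
  that of \<open>n\<close>: a trivial permutation forces the descending factor of the normal form to
  be empty.\<close>

lemma typeA_eq_Nil_if_word_perm:
  assumes "m \<le> n" "set w \<subseteq> {..<m}" "word_perm w = id"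
  shows "typeA_eq n w []"
  using assms
proof (induction m arbitrary: w)
  case 0
  then show ?case by (simp add: typeA_eq_refl)
next
  case (Suc m)
  obtain u k where u: "set u \<subseteq> {..<m}" "k \<le> Suc m" "typeA_eq n w (u @ rev [k..<Suc m])"
    using typeA_normal_form[OF Suc.prems(1,2)] by auto
  have perm: "word_perm (u @ rev [k..<Suc m]) = id"
    using word_perm_typeA_eq[OF u(3)] Suc.prems(3) by (simp only:)
  \<comment> \<open>Letters below \<open>m\<close> move only the points from \<open>0\<close> to
    \<open>m\<close>, so the descending factor alone decides where \<open>Suc m\<close>
    goes.\<close>
  have "word_perm u (Suc m) = Suc m"
    using word_perm_permutes[OF u(1)] by (rule permutes_not_in) simp
  then have "word_perm (u @ rev [k..<Suc m]) (Suc m) = k"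
    using word_perm_descending[OF u(2)] by (simp only: word_perm_append comp_apply)
  then have "k = Suc m" unfolding perm by simp
  then have "typeA_eq n w u" "word_perm u = id"
    using u(3) perm by (simp_all del: upt_Suc)
  with Suc.IH[of u] Suc.prems(1) u(1) show ?case by (auto intro: typeA_eq_trans)
qed

section \<open>Permutations commuting with all adjacent transpositions\<close>

lemma word_perm_commutes_imp_id:
  assumes "n \<ge> 2" and w: "set w \<subseteq> {..<n}"
    and comm: "\<And>s i. s < n \<Longrightarrow> i \<le> n \<Longrightarrow>
      word_perm w (transpose s (Suc s) i) = transpose s (Suc s) (word_perm w i)"
  shows "word_perm w = id"
proof -
  let ?p = "word_perm w"
  have p: "?p permutes {..n}" by (rule word_perm_permutes[OF w])
  then have inj: "?p i = ?p j \<longleftrightarrow> i = j" for i j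
    by (auto simp: permutes_inj inj_eq)
  \<comment> \<open>If \<open>?p s\<close> were outside \<open>{s, Suc s}\<close>, the transposition
    would fix it, and commutation would give \<open>?p (Suc s) = ?p s\<close>, against injectivity;
    likewise for \<open>Suc s\<close>.\<close>
  have pair: "?p s \<in> {s, Suc s} \<and> ?p (Suc s) \<in> {s, Suc s}" if "s < n" for s
    using comm[OF that, of s] comm[OF that, of "Suc s"] inj[of s "Suc s"] that
    by (auto simp: transpose_def split: if_splits)
  \<comment> \<open>An interior point is the only common element of two consecutive pairs.\<close>
  have inner: "?p (Suc s) = Suc s" if "Suc s < n" for s
    using pair[of s] pair[of "Suc s"] that by auto
  have "?p i = i" for i
  proof -
    \<comment> \<open>For an end point, the other element of its pair is interior and already fixed,
      which leaves one value; \<open>n \<ge> 2\<close> provides this interior point.\<close>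
    consider "i = 0" | "0 < i" "i < n" | "i = n" | "i > n" by linarith
    then show ?thesis
    proof cases
      case 1
      then show ?thesis using pair[of 0] inner[of 0] inj[of 0 1] assms(1) by auto
    next
      case 2
      then show ?thesis using inner[of "i - 1"] by simp
    next
      case 3
      then obtain m where m: "i = Suc (Suc m)" "n = Suc (Suc m)"
        using assms(1) by (cases n; cases "n - 1") auto
      then show ?thesis using pair[of "Suc m"] inner[of m] inj[of i "Suc m"] by auto
    next
      case 4
      then show ?thesis using permutes_not_in[OF p] by simp
    qed
  qed
  then show ?thesis by (simp add: fun_eq_iff)
qed

section \<open>The matrix of a word\<close>

text \<open>The linear map from the \<open>n + 1\<close> values \<open>y 0\<close>, ...,
  \<open>y n\<close> to \<open>n\<close> coordinates. Taking \<open>y\<close> as a total function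
  lets permutations act by composition.\<close>

definition adjacent_sums :: "nat \<Rightarrow> (nat \<Rightarrow> bit) \<Rightarrow> bit vec" where
  "adjacent_sums n y = vec n (\<lambda>i. y i + y (Suc i))"

lemma adjacent_sums_carrier: "adjacent_sums n y \<in> carrier_vec n"
  by (simp add: adjacent_sums_def)

text \<open>The matrix adds coordinate \<open>s\<close>, that is \<open>y s + y (Suc s)\<close>, to
  the neighbouring coordinates, where the term occurring twice vanishes over the two-element field.
  Coordinate \<open>s\<close> itself is symmetric in the two exchanged values.\<close>

lemma vogan_matrix_adjacent_sums:
  assumes "s < n"
  shows "vogan_matrix n (typeA_edges n) s *\<^sub>v adjacent_sums n y =
    adjacent_sums n (y \<circ> transpose s (Suc s))"
proof (rule eq_vecI)
  fix i assume "i < dim_vec (adjacent_sums n (y \<circ> transpose s (Suc s)))"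
  then have i: "i < n" by (simp add: adjacent_sums_def)
  have cancel: "a + b + (b + c) = a + c" "b + c + (a + b) = a + c" for a b c :: bit
    by (cases a; cases b; cases c; simp)+
  have "(vogan_matrix n (typeA_edges n) s *\<^sub>v adjacent_sums n y) $ i =
      y i + y (Suc i) + (if s = Suc i \<or> i = Suc s then y s + y (Suc s) else 0)"
    unfolding vogan_matrix_action[OF adjacent_sums_carrier i assms]
    using i assms by (simp add: adjacent_sums_def typeA_edges_iff)
  also have "\<dots> = adjacent_sums n (y \<circ> transpose s (Suc s)) $ i"
  proof -
    consider "i = s" | "i = Suc s" | "s = Suc i" | "i \<noteq> s" "i \<noteq> Suc s" "s \<noteq> Suc i" by blast
    then show ?thesis
    proof cases
      case 1
      have "adjacent_sums n (y \<circ> transpose s (Suc s)) $ i = y (Suc i) + y i"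
        using 1 i by (simp add: adjacent_sums_def)
      then show ?thesis
        using 1 by (simp only: n_not_Suc_n simp_thms if_False add_0_left add_0_right add.commute)
    next
      case 2
      have "adjacent_sums n (y \<circ> transpose s (Suc s)) $ i = y s + y (Suc i)"
        using 2 i by (simp add: adjacent_sums_def)
      then show ?thesis using 2 by (simp only: cancel simp_thms if_True)
    next
      case 3
      have "adjacent_sums n (y \<circ> transpose s (Suc s)) $ i = y i + y (Suc s)"
        using 3 i by (simp add: adjacent_sums_def)
      then show ?thesis using 3 by (simp only: cancel simp_thms if_True)
    qed (use i in \<open>simp_all add: adjacent_sums_def\<close>)
  qed
  finally show "(vogan_matrix n (typeA_edges n) s *\<^sub>v adjacent_sums n y) $ i =
      adjacent_sums n (y \<circ> transpose s (Suc s)) $ i" .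
qed (simp add: adjacent_sums_def)

text \<open>In characteristic two \<open>y i + z i\<close> is a difference, and the kernel of taking
  adjacent sums consists of the functions constant on \<open>{..n}\<close>.\<close>

lemma adjacent_sums_eqD:
  assumes "adjacent_sums n y = adjacent_sums n z" "i \<le> n"
  shows "y i + z i = y 0 + z 0"
  using assms(2)
proof (induction i)
  case (Suc i)
  have "adjacent_sums n y $ i = adjacent_sums n z $ i" using assms(1) by simp
  then have "y i + y (Suc i) = z i + z (Suc i)" using Suc.prems by (simp add: adjacent_sums_def)
  with Suc show ?case
    by (cases "y i"; cases "y (Suc i)"; cases "z i"; cases "z (Suc i)") auto
qed simp

text \<open>
  If \<open>p\<close> and \<open>q\<close> differ at \<open>i\<close>, testing with the characteristic function of \<open>p i\<close> forces every
  index to be sent to \<open>p i\<close> by one of them, which allows only two indices.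
\<close>

lemma permutes_eq_if_adjacent_sums_eq:
  assumes "n \<ge> 2" and p: "p permutes {..n}" and q: "q permutes {..n}"
    and eq: "\<And>y. adjacent_sums n (y \<circ> p) = adjacent_sums n (y \<circ> q)"
  shows "p = q"
proof (rule ccontr)
  assume "p \<noteq> q"
  then obtain i where ne: "p i \<noteq> q i" by (auto simp: fun_eq_iff)
  then have i: "i \<le> n" using p q by (metis atMost_iff permutes_not_in)
  define y where "y j = (if j = p i then 1 else 0 :: bit)" for j
  have "p j = p i \<or> q j = p i" if "j \<le> n" for j
  proof (rule ccontr)
    assume "\<not> ?thesis"
    then show False
      using adjacent_sums_eqD[OF eq[of y] that] adjacent_sums_eqD[OF eq[of y] i] ne
      by (auto simp: y_def)
  qed
  then have "j = i \<or> j = inv_into UNIV q (p i)" if "j \<le> n" for j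
    using that permutes_inj[OF p] permutes_inverses(2)[OF q] by (metis injD)
  then have "{..n} \<subseteq> {i, inv_into UNIV q (p i)}" by auto
  then have "card {..n} \<le> card {i, inv_into UNIV q (p i)}" by (intro card_mono) auto
  also have "\<dots> \<le> 2" by (simp add: card_insert_if)
  finally show False using assms(1) by simp
qed

section \<open>Elements of the Coxeter group as classes of words\<close>

definition typeA_class :: "nat \<Rightarrow> nat list \<Rightarrow> (nat \<times> bool) list set" where
  "typeA_class n w = pres_class {0..<n} (coxeter_relators n (typeA_edges n)) (gen_word w)"

lemma typeA_class_closed:
  "set w \<subseteq> {..<n} \<Longrightarrow> typeA_class n w \<in> carrier (coxeter_group n (typeA_edges n))"
  by (simp add: typeA_class_def coxeter_group_def pres_class_closed gen_word_in_words)

lemma typeA_class_append: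
  "set u \<subseteq> {..<n} \<Longrightarrow> set v \<subseteq> {..<n} \<Longrightarrow>
    typeA_class n (u @ v) =
    typeA_class n u \<otimes>\<^bsub>coxeter_group n (typeA_edges n)\<^esub> typeA_class n v"
  by (simp add: typeA_class_def coxeter_group_def presented_group_mult gen_word_in_words)

lemma typeA_class_Nil: "typeA_class n [] = \<one>\<^bsub>coxeter_group n (typeA_edges n)\<^esub>"
  by (simp add: typeA_class_def coxeter_group_def presented_group_one)

lemma typeA_class_eq_iff:
  "set u \<subseteq> {..<n} \<Longrightarrow> set v \<subseteq> {..<n} \<Longrightarrow>
    typeA_class n u = typeA_class n v \<longleftrightarrow> typeA_eq n u v"
  by (simp add: typeA_class_def typeA_eq_def pres_class_eq_iff gen_word_in_words)

lemma typeA_class_cases: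
  assumes "X \<in> carrier (coxeter_group n (typeA_edges n))"
  obtains w where "set w \<subseteq> {..<n}" "X = typeA_class n w"
proof -
  let ?C = "pres_cong {0..<n} (coxeter_relators n (typeA_edges n))"
  obtain v where v: "v \<in> words {0..<n}"
    "X = pres_class {0..<n} (coxeter_relators n (typeA_edges n)) v"
    using assms unfolding coxeter_group_def by (elim presented_group_cases)
  have letter: "([(s, b)], [(s, True)]) \<in> ?C" if s: "s < n" for s b
  proof (cases b)
    case True
    then show ?thesis using s by (auto simp: words_Cons words_Nil intro: pres_cong.refl)
  next
    case False
    have w: "[(s, b)] \<in> words {0..<n}" for b using s by (simp add: words_Cons words_Nil)
    \<comment> \<open>The word for the product of the inverse of \<open>s\<close> with
      \<open>s\<close> twice reduces in two ways: the relator leaves the inverse of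
      \<open>s\<close>, free cancellation leaves \<open>s\<close>.\<close>
    have "([(s, False)] @ [(s, True), (s, True)], [(s, False)] @ []) \<in> ?C"
      using typeA_eq_square[OF s] w by (intro pres_cong.append pres_cong.refl) (auto simp: typeA_eq_def)
    moreover have "([(s, False), (s, True)] @ [(s, True)], [] @ [(s, True)]) \<in> ?C"
      using pres_cong.cancel[of s "{0..<n}" False] s w
      by (intro pres_cong.append pres_cong.refl) auto
    ultimately show ?thesis
      using False by (auto intro: pres_cong.sym pres_cong.trans)
  qed
  have "(v, gen_word (map fst v)) \<in> ?C"
    using v(1)
  proof (induction v)
    case (Cons a v)
    then show ?case
      using pres_cong.append[OF letter[of "fst a" "snd a"], of v "gen_word (map fst v)"]
      by (cases a) (simp add: words_Cons)
  qed (simp add: pres_cong.refl words_Nil)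
  moreover have set: "set (map fst v) \<subseteq> {..<n}" using v(1) by (auto simp: words_def)
  ultimately have "X = typeA_class n (map fst v)"
    using v by (simp add: typeA_class_def pres_class_eq_iff gen_word_in_words)
  then show thesis using that set by blast
qed

text \<open>The orders agree: in the image of \<open>s # w\<close> the matrix of \<open>s\<close>
  acts last and precomposes \<open>y \<circ> word_perm w\<close> with the transposition, just as
  \<open>word_perm (s # w)\<close> does.\<close>

lemma vogan_representation_adjacent_sums:
  assumes "vogan_representation n (typeA_edges n) \<phi>" "set w \<subseteq> {..<n}"
  shows "\<phi> (typeA_class n w) *\<^sub>v adjacent_sums n y = adjacent_sums n (y \<circ> word_perm w)"
proof -
  let ?W = "coxeter_group n (typeA_edges n)"
  interpret hom: group_hom ?W "GL_F2 n" \<phi>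
    using assms(1) group_coxeter_group group_GL_F2
    by (simp add: vogan_representation_def group_hom_def group_hom_axioms_def)
  show ?thesis
    using assms(2)
  proof (induction w arbitrary: y)
    case Nil
    then show ?case
      using hom.hom_one by (simp add: typeA_class_Nil GL_F2_simps adjacent_sums_carrier)
  next
    case (Cons s w)
    have gen: "\<phi> (typeA_class n [s]) = vogan_matrix n (typeA_edges n) s"
      using assms(1) Cons.prems
      by (simp add: vogan_representation_def coxeter_gen_def typeA_class_def)
    have "\<phi> (typeA_class n w) \<in> carrier (GL_F2 n)"
      using Cons.prems typeA_class_closed by simp
    then have cl: "\<phi> (typeA_class n w) \<in> carrier_mat n n"
      by (auto simp: GL_F2_def units_of_def Units_def ring_mat_def)
    have "\<phi> (typeA_class n (s # w)) = vogan_matrix n (typeA_edges n) s * \<phi> (typeA_class n w)"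
      using typeA_class_append[of "[s]" n w] Cons.prems gen typeA_class_closed
      by (simp add: GL_F2_simps)
    then show ?case
      using Cons cl vogan_matrix_adjacent_sums[of s n "y \<circ> word_perm w"]
      by (simp add: assoc_mult_mat_vec[OF vogan_matrix_carrier cl adjacent_sums_carrier] comp_def)
  qed
qed

lemma word_perm_eq_if_vogan_representation_eq:
  assumes "n \<ge> 2" "vogan_representation n (typeA_edges n) \<phi>"
    and "set u \<subseteq> {..<n}" "set v \<subseteq> {..<n}" "\<phi> (typeA_class n u) = \<phi> (typeA_class n v)"
  shows "word_perm u = word_perm v"
  using assms
  by (intro permutes_eq_if_adjacent_sums_eq[OF assms(1)] word_perm_permutes)
    (simp_all flip: vogan_representation_adjacent_sums)

theorem proposition5p7:
  fixes n :: nat and \<phi> :: "(nat \<times> bool) list set \<Rightarrow> bit mat"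
  defines "W \<equiv> coxeter_group n (typeA_edges n)"
  assumes "n \<ge> 2"
    and "vogan_representation n (typeA_edges n) \<phi>"
  shows "inj_on \<phi> (carrier W) \<and>
    kernel W (GL_F2 n) \<phi> = group_center W \<and>
    group_center W = {\<one>\<^bsub>W\<^esub>}"
proof -
  interpret hom: group_hom W "GL_F2 n" \<phi>
    using assms group_coxeter_group group_GL_F2
    by (simp add: vogan_representation_def group_hom_def group_hom_axioms_def)
  \<comment> \<open>Kernel and centre both reduce to this: their elements are shown to induce the
    identity permutation.\<close>
  have trivial: "typeA_class n w = \<one>\<^bsub>W\<^esub>" if "set w \<subseteq> {..<n}" "word_perm w = id" for w
    using typeA_eq_Nil_if_word_perm[OF order_refl that] that(1)
    by (simp add: W_def typeA_class_eq_iff flip: typeA_class_Nil)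
  have "X = \<one>\<^bsub>W\<^esub>" if X: "X \<in> kernel W (GL_F2 n) \<phi>" for X
  proof -
    obtain w where w: "set w \<subseteq> {..<n}" "X = typeA_class n w"
      using X typeA_class_cases[of X n] unfolding kernel_def W_def by blast
    have "\<phi> (typeA_class n w) = \<phi> (typeA_class n [])"
      using X w hom.hom_one by (simp add: kernel_def typeA_class_Nil flip: W_def)
    then have "word_perm w = word_perm []"
      using w by (intro word_perm_eq_if_vogan_representation_eq[OF assms(2,3)]) auto
    then show ?thesis using trivial w by simp
  qed
  then have ker: "kernel W (GL_F2 n) \<phi> = {\<one>\<^bsub>W\<^esub>}"
    using hom.hom_one by (auto simp: kernel_def)
  have "X = \<one>\<^bsub>W\<^esub>" if X: "X \<in> group_center W" for X
  proof -
    obtain w where w: "set w \<subseteq> {..<n}" "X = typeA_class n w"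
      using X typeA_class_cases[of X n] unfolding group_center_def W_def by blast
    \<comment> \<open>Testing a central element against single generators is enough: its permutation
      then commutes with every adjacent transposition.\<close>
    have "word_perm (w @ [s]) = word_perm ([s] @ w)" if "s < n" for s
    proof (rule word_perm_typeA_eq)
      have s: "set [s] \<subseteq> {..<n}" using that by simp
      then have "typeA_class n w \<otimes>\<^bsub>W\<^esub> typeA_class n [s] =
          typeA_class n [s] \<otimes>\<^bsub>W\<^esub> typeA_class n w"
        using X w typeA_class_closed[OF s] by (simp add: group_center_def W_def)
      then show "typeA_eq n (w @ [s]) ([s] @ w)"
        using w(1) s typeA_class_append[OF w(1) s] typeA_class_append[OF s w(1)]
        by (subst typeA_class_eq_iff[symmetric]) (auto simp: W_def)
    qed
    then have "word_perm w = id"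
      by (intro word_perm_commutes_imp_id[OF assms(2) w(1)])
        (simp add: word_perm_append fun_eq_iff)
    then show ?thesis using trivial w by simp
  qed
  then have "group_center W = {\<one>\<^bsub>W\<^esub>}"
    by (auto simp: group_center_def)
  then show ?thesis
    using ker hom.inj_iff_trivial_ker by simp
qed

end
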